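(* Let $q>3$ be a prime power and let $\overline{\mathbb{F}_q}$ be an algebraic closure of the finite field $\mathbb{F}_q$. Let $A$ and $B$ be $\mathbb{F}_q$-subspaces of $\overline{\mathbb{F}_q}$ of size $q^3$, with $A^{-1}\not\subseteq B$. If $$\frac{|A^{-1}\cap B|}{q-1}>2q+1,$$ then $(A^{-1}\cap B)\cup\{0\}$ contains a one-dimensional $\mathbb{F}_{q^2}$-subspace of $\overline{\mathbb{F}_q}$.
   Context: For an $\mathbb{F}_q$-subspace $A$ of $\overline{\mathbb{F}_q}$, $A^{-1}=\{x^{-1}: 0\neq x\in A\}$ is the set of inverses of the nonzero elements of $A$. $\mathbb{F}_{q^2}$ denotes the subfield of $\overline{\mathbb{F}_q}$ with $q^2$ elements; a one-dimensional $\mathbb{F}_{q^2}$-subspace of $\overline{\mathbb{F}_q}$ is a set of the form $\mathbb{F}_{q^2}\xi$ with $\xi\in\overline{\mathbb{F}_q}$, $\xi\neq 0$. *)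

theory Defs
  imports "HOL-Computational_Algebra.Polynomial" "HOL-Library.Cardinality"
begin

text \<open>
  An algebraic closure of the field \<open>'f\<close> is given by an embedding into an algebraically closed
  field \<open>'c\<close> (by the sort constraint) that is algebraic over the image of \<open>'f\<close>. The embedding
  \<open>to_ac :: 'f \<Rightarrow> 'f alg_closure\<close> of \<open>HOL-Algebra.Algebraic_Closure_Type\<close> is one instance.
  Injectivity is automatic, since a unital ring homomorphism between fields is injective.
\<close>

definition algebraic_closure_embedding :: "('f::field \<Rightarrow> 'c::alg_closed_field) \<Rightarrow> bool" where
  "algebraic_closure_embedding \<iota> \<longleftrightarrow>
     \<iota> 1 = 1 \<and> (\<forall>x y. \<iota> (x + y) = \<iota> x + \<iota> y) \<and> (\<forall>x y. \<iota> (x * y) = \<iota> x * \<iota> y) \<and>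
     (\<forall>z. \<exists>p. p \<noteq> 0 \<and> poly (map_poly \<iota> p) z = 0)"

definition is_subfield :: "'c::field set \<Rightarrow> bool" where
  "is_subfield F \<longleftrightarrow>
     1 \<in> F \<and> (\<forall>x\<in>F. \<forall>y\<in>F. x - y \<in> F) \<and> (\<forall>x\<in>F. \<forall>y\<in>F. x * y \<in> F) \<and>
     (\<forall>x\<in>F. inverse x \<in> F)"

definition inverse_set :: "'c::field set \<Rightarrow> 'c set" where
  "inverse_set A = {inverse x | x. x \<in> A \<and> x \<noteq> 0}"

text \<open>
  The subfield with \<open>q\<^sup>2\<close> elements of an algebraic closure of a field with \<open>q\<close> elements is unique,
  so in the following definition, with \<open>n = q\<^sup>2\<close>, the field \<open>F\<close> is determined by \<open>n\<close>.
\<close>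

definition one_dim_subspace_over_subfield_of_card :: "nat \<Rightarrow> 'c::field set \<Rightarrow> bool" where
  "one_dim_subspace_over_subfield_of_card n S \<longleftrightarrow>
     (\<exists>F \<xi>. is_subfield F \<and> card F = n \<and> \<xi> \<noteq> 0 \<and> S = {c * \<xi> | c. c \<in> F})"

end

theory Submission
  imports Defs
begin

text \<open>
  If \<open>L\<close> is the linearized polynomial with kernel \<open>B\<close>, then clearing denominators in \<open>L(1/x)\<close> gives a
  form \<open>F\<close> that is cubic over \<open>F\<^sub>q\<close>, so that the points of \<open>A\<^sup>-\<^sup>1 \<inter> B\<close> lie on a cubic in the
  projective plane of \<open>A\<close>. If this cubic contains an \<open>F\<^sub>q\<close>-line, a degree argument yields the
  quadratic subfield. Otherwise each line contains at most three zeros. If there were more than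
  \<open>2q + 1\<close> zeros, then counting on the lines through a zero shows that each contains a further zero
  and at most one of them has fewer than three zeros altogether. The tangent at every zero is then
  rational, hence is the exceptional line and also the tangent at its second zero, which is absurd.
\<close>

section \<open>Finite fields and finite subrings\<close>

lemma card_field_gt_1: "CARD('f::{field,finite}) > 1"
proof -
  have "card {0, 1 :: 'f} \<le> CARD('f)" by (rule card_mono) auto
  then show ?thesis by simp
qed

text \<open>Multiplication by a nonzero \<open>c\<close> permutes the nonzero elements, so their
  product equals itself times \<open>c^(q-1)\<close>.\<close>

lemma finite_field_power_card: "(c::'f::{field,finite}) ^ CARD('f) = c"
proof (cases "c = 0")
  case True
  then show ?thesis by (simp add: card_gt_0_iff)
next
  case False
  let ?N = "UNIV - {0::'f}"
  have "(\<Prod>x\<in>?N. x) = (\<Prod>x\<in>?N. c * x)"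
    by (rule prod.reindex_bij_witness[of _ "\<lambda>x. c * x" "\<lambda>x. x / c"]) (use False in auto)
  also have "\<dots> = c ^ card ?N * (\<Prod>x\<in>?N. x)"
    by (simp add: prod.distrib)
  finally have "c ^ card ?N = 1" by simp
  then have "c ^ Suc (card ?N) = c" by (simp only: power_Suc mult_1_right)
  also have "Suc (card ?N) = CARD('f)"
    by (metis card.remove finite UNIV_I)
  finally show ?thesis .
qed

text \<open>With \<open>q = CARD('f)\<close>, the polynomial \<open>(X + 1)\<^sup>q - X\<^sup>q - 1\<close> vanishes on the whole field but has
  degree less than \<open>q\<close>, hence it is zero.\<close>

lemma of_nat_choose_card_eq_0:
  assumes "0 < k" "k < CARD('f::{field,finite})"
  shows "(of_nat (CARD('f) choose k) :: 'f) = 0"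
proof -
  define q where "q = CARD('f)"
  define p :: "'f poly" where "p = (\<Sum>k\<in>{0<..<q}. monom (of_nat (q choose k)) k)"
  have root: "poly p x = 0" for x
  proof -
    have q0: "q > 0" using assms by (simp add: q_def)
    have "x + 1 = (x + 1) ^ q" by (simp add: q_def finite_field_power_card)
    also have "\<dots> = (\<Sum>k\<le>q. of_nat (q choose k) * x ^ k)"
      by (subst binomial_ring) simp
    also have "{..q} = insert 0 (insert q {0<..<q})" using q0 by auto
    also have "(\<Sum>k\<in>insert 0 (insert q {0<..<q}). of_nat (q choose k) * x ^ k)
        = 1 + (x + (\<Sum>k\<in>{0<..<q}. of_nat (q choose k) * x ^ k))"
      using q0 by (simp add: finite_field_power_card q_def)
    finally show ?thesis by (simp add: p_def poly_sum poly_monom)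
  qed
  have "p = 0"
  proof (rule ccontr)
    assume "p \<noteq> 0"
    have "degree p \<le> q - 1"
      unfolding p_def by (rule degree_sum_le) (auto intro!: order_trans[OF degree_monom_le])
    moreover have "card {x. poly p x = 0} \<le> degree p"
      using \<open>p \<noteq> 0\<close> by (rule card_poly_roots_bound)
    ultimately show False using root assms by (simp add: q_def)
  qed
  then have "coeff p k = 0" by simp
  then show ?thesis using assms by (simp add: p_def coeff_sum q_def)
qed

text \<open>Multiplication by a nonzero \<open>x\<close> is injective on the finite set
  \<open>E\<close>, hence onto, and so reaches 1.\<close>

lemma finite_subring_is_subfield:
  fixes E :: "'c::field set"
  assumes "finite E" "1 \<in> E"
    and diff: "\<And>x y. x \<in> E \<Longrightarrow> y \<in> E \<Longrightarrow> x - y \<in> E"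
    and mult: "\<And>x y. x \<in> E \<Longrightarrow> y \<in> E \<Longrightarrow> x * y \<in> E"
  shows "is_subfield E"
proof -
  have "inverse x \<in> E" if "x \<in> E" for x
  proof (cases "x = 0")
    case False
    have "(\<lambda>y. x * y) ` E \<subseteq> E" using mult that by auto
    moreover have "inj_on (\<lambda>y. x * y) E" using False by (simp add: inj_on_def)
    ultimately have "(\<lambda>y. x * y) ` E = E" using \<open>finite E\<close> by (simp add: endo_inj_surj)
    then obtain y where "y \<in> E" "x * y = 1" using \<open>1 \<in> E\<close> by (metis imageE)
    then show ?thesis using inverse_unique by metis
  qed (use that in simp)
  then show ?thesis unfolding is_subfield_def using assms by blast
qed

section \<open>Scalars, Frobenius map and linear algebra over the finite field\<close>

locale finite_scalars =
  fixes \<iota> :: "'f::{field,finite} \<Rightarrow> 'c::field"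
  assumes one [simp]: "\<iota> 1 = 1"
    and add: "\<iota> (x + y) = \<iota> x + \<iota> y"
    and mult: "\<iota> (x * y) = \<iota> x * \<iota> y"
begin

lemma zero [simp]: "\<iota> 0 = 0"
  using add[of 0 0] by (metis add.right_neutral add_left_cancel)

lemma uminus: "\<iota> (- x) = - \<iota> x"
  using add[of x "- x"] by (simp add: add_eq_0_iff)

lemma diff: "\<iota> (x - y) = \<iota> x - \<iota> y"
  using add[of x "- y"] by (simp add: uminus)

lemma power: "\<iota> (x ^ n) = \<iota> x ^ n"
  by (induction n) (simp_all add: mult)

lemma eq_0_iff [simp]: "\<iota> x = 0 \<longleftrightarrow> x = 0"
proof
  assume "\<iota> x = 0"
  then have "\<iota> (x * inverse x) = 0" by (simp add: mult)
  then show "x = 0" by (cases "x = 0") auto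
qed simp

lemma eq_iff [simp]: "\<iota> x = \<iota> y \<longleftrightarrow> x = y"
  using eq_0_iff[of "x - y"] by (simp add: diff)

lemma inverse: "\<iota> (inverse x) = inverse (\<iota> x)"
proof (cases "x = 0")
  case False
  then have "\<iota> x * \<iota> (inverse x) = 1" by (simp flip: mult)
  then show ?thesis by (metis inverse_unique)
qed simp

lemma divide: "\<iota> (x / y) = \<iota> x / \<iota> y"
  by (simp add: divide_inverse mult inverse)

lemma of_nat: "\<iota> (of_nat n) = of_nat n"
  by (induction n) (simp_all add: add)

lemmas hom = add mult uminus diff power inverse divide of_nat

definition frob :: "'c \<Rightarrow> 'c" where "frob x = x ^ CARD('f)"

text \<open>The inner binomial coefficients vanish in \<open>'f\<close>, and \<open>\<iota>\<close>
  carries this over to \<open>'c\<close>.\<close>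

lemma frob_add: "frob (x + y) = frob x + frob y"
proof -
  define q where "q = CARD('f)"
  have q0: "q > 0" by (simp add: q_def card_gt_0_iff)
  have ch: "(of_nat (q choose k) :: 'c) = 0" if "0 < k" "k < q" for k
    using of_nat_choose_card_eq_0[where 'f='f, of k] that unfolding q_def
    by (metis of_nat zero)
  have "(x + y) ^ q = (\<Sum>k\<le>q. of_nat (q choose k) * x ^ k * y ^ (q - k))"
    by (rule binomial_ring)
  also have "{..q} = insert 0 (insert q {0<..<q})" using q0 by auto
  also have "(\<Sum>k\<in>insert 0 (insert q {0<..<q}). of_nat (q choose k) * x ^ k * y ^ (q - k))
      = y ^ q + (x ^ q + (\<Sum>k\<in>{0<..<q}. of_nat (q choose k) * x ^ k * y ^ (q - k)))"
    using q0 by simp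
  also have "(\<Sum>k\<in>{0<..<q}. of_nat (q choose k) * x ^ k * y ^ (q - k)) = 0"
    by (rule sum.neutral) (simp add: ch)
  finally show ?thesis by (simp add: frob_def q_def)
qed

lemma frob_mult: "frob (x * y) = frob x * frob y"
  by (simp add: frob_def power_mult_distrib)

lemma frob_inverse: "frob (inverse x) = inverse (frob x)"
  by (simp add: frob_def power_inverse)

lemma frob_divide: "frob (x / y) = frob x / frob y"
  by (simp add: divide_inverse frob_mult frob_inverse)

lemma frob_eq_0_iff [simp]: "frob x = 0 \<longleftrightarrow> x = 0"
  by (simp add: frob_def card_gt_0_iff)

lemma frob_scalar [simp]: "frob (\<iota> c) = \<iota> c"
  by (simp add: frob_def finite_field_power_card flip: power)

text \<open>The polynomial \<open>X^q - X\<close> has at most \<open>q\<close> roots, and the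
  \<open>q\<close> scalars already are roots.\<close>

lemma frob_fixed: "frob x = x \<longleftrightarrow> x \<in> range \<iota>"
proof -
  define q where "q = CARD('f)"
  define p :: "'c poly" where "p = monom 1 q - monom 1 1"
  have q1: "q > 1" using card_field_gt_1[where 'f='f] by (simp add: q_def)
  have "coeff p q = 1" using q1 by (simp add: p_def)
  then have p0: "p \<noteq> 0" by auto
  have deg: "degree p \<le> q" unfolding p_def
    by (rule degree_diff_le) (use q1 in \<open>auto intro!: order_trans[OF degree_monom_le]\<close>)
  have roots: "{x. poly p x = 0} = {x. frob x = x}"
    by (auto simp: p_def poly_monom frob_def q_def)
  have "range \<iota> = {x. poly p x = 0}"
  proof (rule card_seteq)
    show "finite {x. poly p x = 0}" using p0 by (rule poly_roots_finite)
    show "range \<iota> \<subseteq> {x. poly p x = 0}" unfolding roots by auto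
    have "card (range \<iota>) = q" unfolding q_def by (rule card_image) (simp add: inj_on_def)
    then show "card {x. poly p x = 0} \<le> card (range \<iota>)"
      using card_poly_roots_bound[OF p0] deg by simp
  qed
  then show ?thesis using roots by auto
qed

text \<open>Makes the local \<open>subspace\<close> agree with the \<open>module.subspace\<close> of
  the theorem.\<close>

sublocale vector_space "\<lambda>c x. \<iota> c * x"
  by unfold_locales (simp_all add: algebra_simps hom)

declare scale_scale [simp del]

lemma subspace_comb:
  assumes "subspace V" "x \<in> V" "y \<in> V"
  shows "\<iota> a * x + \<iota> b * y \<in> V"
  using assms subspace_add subspace_scale by metis

text \<open>Projectively, \<open>indep2\<close> describes two distinct points and
  \<open>indep3\<close> three points that are not collinear.\<close>

definition indep2 :: "'c \<Rightarrow> 'c \<Rightarrow> bool" where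
  "indep2 x y \<longleftrightarrow> (\<forall>a b. \<iota> a * x + \<iota> b * y = 0 \<longrightarrow> a = 0 \<and> b = 0)"

definition indep3 :: "'c \<Rightarrow> 'c \<Rightarrow> 'c \<Rightarrow> bool" where
  "indep3 x y z \<longleftrightarrow>
     (\<forall>a b c. \<iota> a * x + \<iota> b * y + \<iota> c * z = 0 \<longrightarrow> a = 0 \<and> b = 0 \<and> c = 0)"

lemma indep2I:
  assumes "x \<noteq> 0" "\<And>a. y \<noteq> \<iota> a * x"
  shows "indep2 x y"
  unfolding indep2_def
proof (intro allI impI)
  fix a b assume ab: "\<iota> a * x + \<iota> b * y = 0"
  have "b = 0"
  proof (rule ccontr)
    assume "b \<noteq> 0"
    then have "y = \<iota> (- a / b) * x" using ab by (simp add: hom field_simps eq_neg_iff_add_eq_0)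
    with assms(2) show False by blast
  qed
  with ab assms(1) show "a = 0 \<and> b = 0" by simp
qed

lemma indep2_nonzero: "indep2 x y \<Longrightarrow> x \<noteq> 0"
  unfolding indep2_def by (metis add.right_neutral mult_zero_right mult_zero_left zero zero_neq_one)

lemma indep2_sym: "indep2 x y \<Longrightarrow> indep2 y x"
  unfolding indep2_def by (metis add.commute)

lemma indep2_shift:
  assumes "indep2 x y"
  shows "indep2 x (y + \<iota> a * x)"
  unfolding indep2_def
proof (intro allI impI)
  fix b c assume "\<iota> b * x + \<iota> c * (y + \<iota> a * x) = 0"
  then have "\<iota> (b + c * a) * x + \<iota> c * y = 0" by (simp add: hom algebra_simps)
  with assms have "b + c * a = 0" "c = 0" unfolding indep2_def by blast+
  then show "b = 0 \<and> c = 0" by simp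
qed

lemma indep3_extend:
  assumes "indep2 x y" "\<not> indep3 x y z"
  shows "\<exists>a b. z = \<iota> a * x + \<iota> b * y"
proof -
  obtain a b c where e: "\<iota> a * x + \<iota> b * y + \<iota> c * z = 0" and n: "\<not> (a = 0 \<and> b = 0 \<and> c = 0)"
    using assms(2) unfolding indep3_def by blast
  have c: "c \<noteq> 0" using e n assms(1) unfolding indep2_def by force
  then have "z = \<iota> (- a / c) * x + \<iota> (- b / c) * y"
    using e by (simp add: hom field_simps) (metis add_eq_0_iff)
  then show ?thesis by blast
qed

lemma card_plane: "card {\<iota> a * x + \<iota> b * y |a b. True} \<le> CARD('f) ^ 2"
proof -
  have "{\<iota> a * x + \<iota> b * y |a b. True} = (\<lambda>(a, b). \<iota> a * x + \<iota> b * y) ` UNIV" by auto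
  also have "card \<dots> \<le> card (UNIV :: ('f \<times> 'f) set)" by (rule card_image_le) simp
  finally show ?thesis by (simp add: power2_eq_square)
qed

text \<open>Otherwise all of \<open>V\<close> would lie in the span of \<open>x\<close> and
  \<open>y\<close>, which has at most \<open>q^2\<close> elements.\<close>

lemma indep3_exists:
  assumes "card V = CARD('f) ^ 3" "indep2 x y"
  shows "\<exists>z\<in>V. indep3 x y z"
proof (rule ccontr)
  let ?U = "{\<iota> a * x + \<iota> b * y |a b. True}"
  assume "\<not> ?thesis"
  then have "V \<subseteq> ?U" using indep3_extend[OF assms(2)] by blast
  moreover have "?U = (\<lambda>(a, b). \<iota> a * x + \<iota> b * y) ` UNIV" by auto
  then have "finite ?U" by simp
  ultimately have "CARD('f) ^ 3 \<le> CARD('f) ^ 2"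
    using card_mono[of ?U V] card_plane[of x y] assms(1) by simp
  then show False using power_strict_increasing[of 2 3 "CARD('f)"] card_field_gt_1[where 'f='f] by simp
qed

lemma indep3_inj: "indep3 x y z \<Longrightarrow> inj (\<lambda>(a, b, c). \<iota> a * x + \<iota> b * y + \<iota> c * z)"
proof (rule injI, clarsimp)
  fix a b c a' b' c'
  assume i: "indep3 x y z"
    and "\<iota> a * x + \<iota> b * y + \<iota> c * z = \<iota> a' * x + \<iota> b' * y + \<iota> c' * z"
  then have "\<iota> (a - a') * x + \<iota> (b - b') * y + \<iota> (c - c') * z = 0"
    by (simp add: hom algebra_simps)
  with i show "a = a' \<and> b = b' \<and> c = c'" unfolding indep3_def by fastforce
qed

lemma indep3_spans:
  assumes V: "subspace V" "card V = CARD('f) ^ 3" and i: "indep3 x y z" and xyz: "x \<in> V" "y \<in> V" "z \<in> V"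
  shows "V = range (\<lambda>(a, b, c). \<iota> a * x + \<iota> b * y + \<iota> c * z)" (is "V = range ?f")
proof -
  have "range ?f \<subseteq> V"
    using V(1) xyz by (auto intro!: subspace_add subspace_scale)
  moreover have "finite V" using V(2) by (simp add: card_ge_0_finite)
  moreover have "card (range ?f) = CARD('f \<times> 'f \<times> 'f)"
    by (rule card_image) (rule indep3_inj[OF i])
  then have "card (range ?f) = card V" by (simp add: V(2) power3_eq_cube)
  ultimately show ?thesis by (metis card_subset_eq)
qed

lemma indep2_exists:
  assumes "card V = CARD('f) ^ 3" "x \<noteq> 0"
  shows "\<exists>y\<in>V. indep2 x y"
proof (rule ccontr)
  assume "\<not> ?thesis"
  then have "V \<subseteq> range (\<lambda>a. \<iota> a * x)" using indep2I[OF assms(2)] by blast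
  then have "card V \<le> card (range (\<lambda>a. \<iota> a * x))" by (intro card_mono) auto
  also have "\<dots> \<le> CARD('f)" by (rule card_image_le) simp
  finally show False
    using power_strict_increasing[of 1 3 "CARD('f)"] card_field_gt_1[where 'f='f] assms(1) by simp
qed

lemma indep3_indep2:
  assumes "indep3 x y z"
  shows "indep2 x y" "indep2 x z" "indep2 y z"
proof -
  have "\<iota> a * x + \<iota> b * y + \<iota> c * z = 0 \<Longrightarrow> a = 0 \<and> b = 0 \<and> c = 0" for a b c
    using assms unfolding indep3_def by blast
  from this[where c = 0] this[where b = 0] this[where a = 0]
  show "indep2 x y" "indep2 x z" "indep2 y z" unfolding indep2_def by simp_all
qed

lemma indep3_shift:
  assumes "indep3 x (y + \<iota> s * x) z"
  shows "indep3 x y z"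
  unfolding indep3_def
proof (intro allI impI)
  fix a b c assume "\<iota> a * x + \<iota> b * y + \<iota> c * z = 0"
  then have "\<iota> (a - b * s) * x + \<iota> b * (y + \<iota> s * x) + \<iota> c * z = 0"
    by (simp add: hom algebra_simps)
  with assms have "a - b * s = 0" "b = 0" "c = 0" unfolding indep3_def by blast+
  then show "a = 0 \<and> b = 0 \<and> c = 0" by simp
qed

section \<open>Cubic forms from linearized polynomials\<close>

text \<open>\<open>D x y\<close> is the derivative of the cubic form \<open>F\<close> at \<open>x\<close> in direction \<open>y\<close>.\<close>

definition cubic :: "('c \<Rightarrow> 'c) \<Rightarrow> ('c \<Rightarrow> 'c \<Rightarrow> 'c) \<Rightarrow> bool" where
  "cubic F D \<longleftrightarrow>
     (\<forall>s t x y. F (\<iota> s * x + \<iota> t * y) =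
        \<iota> s ^ 3 * F x + \<iota> s ^ 2 * \<iota> t * D x y + \<iota> s * \<iota> t ^ 2 * D y x + \<iota> t ^ 3 * F y) \<and>
     (\<forall>x s t y z. D x (\<iota> s * y + \<iota> t * z) = \<iota> s * D x y + \<iota> t * D x z) \<and>
     (\<forall>x. D x x = 3 * F x)"

definition scalar_linear :: "('c \<Rightarrow> 'c) \<Rightarrow> bool" where
  "scalar_linear l \<longleftrightarrow> (\<forall>s t x y. l (\<iota> s * x + \<iota> t * y) = \<iota> s * l x + \<iota> t * l y)"

text \<open>The derivative comes from the product rule.\<close>

lemma cubic_mult:
  assumes "scalar_linear k" "scalar_linear l" "scalar_linear m"
  shows "cubic (\<lambda>x. k x * l x * m x) (\<lambda>x y. k x * l x * m y + k x * l y * m x + k y * l x * m x)"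
  using assms unfolding cubic_def scalar_linear_def
  by (simp add: algebra_simps power2_eq_square power3_eq_cube)

lemma cubic_add:
  assumes "cubic F D" "cubic G E"
  shows "cubic (\<lambda>x. F x + G x) (\<lambda>x y. D x y + E x y)"
  using assms unfolding cubic_def by (simp add: algebra_simps)

lemma cubic_scale:
  assumes "cubic F D"
  shows "cubic (\<lambda>x. c * F x) (\<lambda>x y. c * D x y)"
  using assms unfolding cubic_def by (simp add: algebra_simps)

text \<open>Exponents up to \<open>q^3\<close> suffice for a kernel of dimension three over the
  scalars.\<close>

definition linearized :: "'c \<Rightarrow> 'c \<Rightarrow> 'c \<Rightarrow> 'c \<Rightarrow> 'c \<Rightarrow> 'c" where
  "linearized a b c d x = a * x + b * frob x + c * frob (frob x) + d * frob (frob (frob x))"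

lemma linearized_comb:
  "linearized a b c d (x + \<iota> s * y) = linearized a b c d x + \<iota> s * linearized a b c d y"
  by (simp add: linearized_def frob_add frob_mult algebra_simps)

text \<open>If the linearized polynomial \<open>L\<close> has kernel \<open>U\<close>, then \<open>L\<^sup>q - L(v)\<^sup>q\<^sup>-\<^sup>1 L\<close> has kernel \<open>U + \<langle>v\<rangle>\<close>.\<close>

lemma linearized_kernel_step:
  fixes a b c v :: 'c
  shows "\<exists>a' b' c' d'. (\<forall>x. linearized a' b' c' d' x = 0 \<longleftrightarrow>
            (\<exists>s. linearized a b c 0 (x + \<iota> s * v) = 0)) \<and> (c = 0 \<longrightarrow> d' = 0) \<and> (b = 0 \<longrightarrow> c = 0 \<longrightarrow> c' = 0)"
proof (cases "linearized a b c 0 v = 0")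
  case True
  show ?thesis
    by (rule exI[of _ a], rule exI[of _ b], rule exI[of _ c], rule exI[of _ 0])
      (simp add: linearized_comb True)
next
  case False
  let ?L = "linearized a b c 0"
  \<comment> \<open>This quotient is \<open>L(v)^(q-1)\<close>, chosen so that \<open>L'\<close>
    vanishes at \<open>v\<close>.\<close>
  define e where "e = frob (?L v) / ?L v"
  define L' where "L' = linearized (- e * a) (frob a - e * b) (frob b - e * c) (frob c)"
  have L': "L' x = frob (?L x) - e * ?L x" for x
    by (simp add: L'_def linearized_def frob_add frob_mult algebra_simps)
  have "L' x = 0 \<longleftrightarrow> (\<exists>s. ?L (x + \<iota> s * v) = 0)" for x
  proof -
    \<comment> \<open>Vanishing of \<open>L'\<close> at \<open>x\<close> means that
      \<open>frob\<close> fixes the ratio of \<open>?L x\<close> to \<open>?L v\<close>, so that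
      this ratio is a scalar.\<close>
    have "L' x = 0 \<longleftrightarrow> frob (?L x / ?L v) = ?L x / ?L v"
    proof -
      have "p - r / t * u = 0 \<longleftrightarrow> p / r = u / t" if "r \<noteq> 0" "t \<noteq> 0" for p r t u :: 'c
        using that by (auto simp: field_simps)
      from this[of "frob (?L v)" "?L v" "frob (?L x)" "?L x"] show ?thesis
        using False by (simp add: L' e_def frob_divide)
    qed
    also have "\<dots> \<longleftrightarrow> (\<exists>r. ?L x / ?L v = \<iota> r)" by (auto simp: frob_fixed)
    also have "\<dots> \<longleftrightarrow> (\<exists>r. ?L x = \<iota> r * ?L v)" using False by (simp add: field_simps)
    also have "\<dots> \<longleftrightarrow> (\<exists>s. ?L x = - \<iota> s * ?L v)" by (metis uminus minus_minus)
    also have "\<dots> \<longleftrightarrow> (\<exists>s. ?L (x + \<iota> s * v) = 0)"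
      by (simp add: linearized_comb eq_neg_iff_add_eq_0)
    finally show ?thesis .
  qed
  then show ?thesis unfolding L'_def by (metis diff_zero frob_eq_0_iff mult_zero_right)
qed

text \<open>Start from \<open>L(x) = x\<close>, whose kernel is 0, and adjoin the vectors of a basis
  of \<open>V\<close> one at a time. The side conditions of \<open>linearized_kernel_step\<close>
  keep the higher coefficients zero until they are needed.\<close>

lemma linearized_of_subspace:
  assumes "subspace V" "card V = CARD('f) ^ 3"
  shows "\<exists>a b c d. \<forall>x. linearized a b c d x = 0 \<longleftrightarrow> x \<in> V"
proof -
  have "\<exists>x\<in>V. x \<noteq> 0"
  proof (rule ccontr)
    assume "\<not> ?thesis"
    then have "card V \<le> card {0::'c}" by (intro card_mono) auto
    then show False
      using power_strict_increasing[of 0 3 "CARD('f)"] card_field_gt_1[where 'f='f] assms(2) by simp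
  qed
  then obtain x y z where xyz: "x \<in> V" "y \<in> V" "z \<in> V" and i: "indep3 x y z"
    using indep2_exists[OF assms(2)] indep3_exists[OF assms(2)] by metis
  obtain a1 b1 c1 d1 where 1: "\<And>u. linearized a1 b1 c1 d1 u = 0 \<longleftrightarrow> (\<exists>s. linearized 1 0 0 0 (u + \<iota> s * x) = 0)"
    and z1: "c1 = 0" "d1 = 0"
    using linearized_kernel_step[of 1 0 0 x] by blast
  obtain a2 b2 c2 d2 where 2: "\<And>u. linearized a2 b2 c2 d2 u = 0 \<longleftrightarrow> (\<exists>s. linearized a1 b1 c1 0 (u + \<iota> s * y) = 0)"
    and z2: "d2 = 0"
    using linearized_kernel_step[of a1 b1 c1 y] z1 by blast
  obtain a3 b3 c3 d3 where 3: "\<And>u. linearized a3 b3 c3 d3 u = 0 \<longleftrightarrow> (\<exists>s. linearized a2 b2 c2 0 (u + \<iota> s * z) = 0)"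
    using linearized_kernel_step[of a2 b2 c2 z] by blast
  have "linearized a3 b3 c3 d3 u = 0 \<longleftrightarrow> u \<in> V" for u
  proof -
    have "linearized a3 b3 c3 d3 u = 0 \<longleftrightarrow> (\<exists>r s t. u + \<iota> r * z + \<iota> s * y + \<iota> t * x = 0)"
      using 1 2 3 z1 z2 by (simp add: linearized_def)
    also have "\<dots> \<longleftrightarrow> (\<exists>r s t. u = \<iota> (- t) * x + \<iota> (- s) * y + \<iota> (- r) * z)"
      by (simp add: uminus eq_neg_iff_add_eq_0 algebra_simps)
    also have "\<dots> \<longleftrightarrow> (\<exists>r s t. u = \<iota> t * x + \<iota> s * y + \<iota> r * z)"
      by (metis minus_minus)
    also have "\<dots> \<longleftrightarrow> u \<in> V"
      by (subst indep3_spans[OF assms i xyz]) (auto simp: image_iff)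
    finally show ?thesis .
  qed
  then show ?thesis by blast
qed

text \<open>Multiplying \<open>L(1/x)\<close> by \<open>x\<close> and its three iterated Frobenius
  images leaves in each term a product of three scalar-linear maps.\<close>

lemma cubic_inverse_subspace:
  assumes "subspace V" "card V = CARD('f) ^ 3"
  shows "\<exists>F D. cubic F D \<and> (\<forall>x. F x = 0 \<longleftrightarrow> x = 0 \<or> inverse x \<in> V)"
proof -
  obtain a b c d where L: "\<And>x. linearized a b c d x = 0 \<longleftrightarrow> x \<in> V"
    using linearized_of_subspace[OF assms] by blast
  define f2 where "f2 x = frob (frob x)" for x
  define f3 where "f3 x = frob (f2 x)" for x
  define F where "F x = a * (frob x * f2 x * f3 x) + b * (x * f2 x * f3 x) +
      (c * (x * frob x * f3 x) + d * (x * frob x * f2 x))" for x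
  have lin: "scalar_linear (\<lambda>x. x)" "scalar_linear frob" "scalar_linear f2" "scalar_linear f3"
    unfolding f2_def f3_def
    by (simp_all add: scalar_linear_def frob_add frob_mult)
  have "\<exists>D. cubic F D"
    unfolding F_def
    using cubic_add[OF cubic_add[OF cubic_scale[OF cubic_mult[OF lin(2-4)], of a]
        cubic_scale[OF cubic_mult[OF lin(1,3,4)], of b]]
      cubic_add[OF cubic_scale[OF cubic_mult[OF lin(1,2,4)], of c]
        cubic_scale[OF cubic_mult[OF lin(1,2,3)], of d]]]
    by blast
  moreover have "F x = 0 \<longleftrightarrow> x = 0 \<or> inverse x \<in> V" for x
  proof (cases "x = 0")
    case False
    then have nz: "frob x \<noteq> 0" "f2 x \<noteq> 0" "f3 x \<noteq> 0" by (simp_all add: f2_def f3_def)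
    have "F x = x * frob x * f2 x * f3 x * linearized a b c d (inverse x)"
    proof -
      have "a * (p * r * t) + b * (u * r * t) + (c * (u * p * t) + d * (u * p * r)) =
          u * p * r * t * (a * inverse u + b * inverse p + c * inverse r + d * inverse t)"
        if "u \<noteq> 0" "p \<noteq> 0" "r \<noteq> 0" "t \<noteq> 0" for p r t u
        using that by (simp add: field_simps)
      from this[OF False nz] show ?thesis
        by (simp add: F_def linearized_def frob_inverse f2_def f3_def)
    qed
    then show ?thesis using False nz L by simp
  qed (simp add: F_def f2_def f3_def frob_def card_gt_0_iff)
  ultimately show ?thesis by blast
qed

end

section \<open>Lines contained in the cubic, and the quadratic subfield\<close>

context finite_scalars
begin

text \<open>The relation \<open>t2\<close> reduces products to combinations of 1 and
  \<open>t\<close>, whose coefficients are unique because \<open>t\<close> is not a scalar.\<close>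

lemma quadratic_ring_is_subfield:
  assumes t: "t \<notin> range \<iota>" and t2: "t * t = \<iota> c + \<iota> d * t"
  defines "E \<equiv> range (\<lambda>(a, b). \<iota> a + \<iota> b * t)"
  shows "is_subfield E" "card E = CARD('f) ^ 2"
proof -
  have E: "\<iota> a + \<iota> b * t \<in> E" for a b unfolding E_def by auto
  show "is_subfield E"
  proof (rule finite_subring_is_subfield)
    show "finite E" by (simp add: E_def)
    show "1 \<in> E" using E[of 1 0] by simp
  next
    fix x y assume "x \<in> E" "y \<in> E"
    then obtain a b a' b' where xy: "x = \<iota> a + \<iota> b * t" "y = \<iota> a' + \<iota> b' * t"
      unfolding E_def by auto
    have "x - y = \<iota> (a - a') + \<iota> (b - b') * t" unfolding xy by (simp add: hom algebra_simps)
    then show "x - y \<in> E" using E by simp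
    have "x * y = \<iota> (a * a' + b * b' * c) + \<iota> (a * b' + b * a' + b * b' * d) * t"
      unfolding xy hom using t2 by algebra
    then show "x * y \<in> E" using E by simp
  qed
  have "inj (\<lambda>(a, b). \<iota> a + \<iota> b * t)"
  proof (rule injI, clarsimp)
    fix a b a' b' assume e: "\<iota> a + \<iota> b * t = \<iota> a' + \<iota> b' * t"
    have "b = b'"
    proof (rule ccontr)
      assume "b \<noteq> b'"
      then have "t = \<iota> ((a' - a) / (b - b'))" using e by (simp add: hom field_simps)
      then show False using t by blast
    qed
    with e show "a = a' \<and> b = b'" by simp
  qed
  then show "card E = CARD('f) ^ 2" unfolding E_def by (simp add: card_image power2_eq_square)
qed

lemma cubic_ring_is_subfield:
  assumes t3: "t * t * t = \<iota> c + \<iota> d * t + \<iota> e * (t * t)"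
  shows "is_subfield (range (\<lambda>(a, b, c). \<iota> a * 1 + \<iota> b * t + \<iota> c * (t * t)))" (is "is_subfield ?E")
proof (rule finite_subring_is_subfield)
  have E: "\<iota> a + \<iota> b * t + \<iota> c * (t * t) \<in> ?E" for a b c
    by (rule image_eqI[of _ _ "(a, b, c)"]) simp_all
  show "finite ?E" by simp
  show "1 \<in> ?E" using E[of 1 0 0] by simp
  fix x y assume "x \<in> ?E" "y \<in> ?E"
  then obtain a1 b1 c1 a2 b2 c2
    where xy: "x = \<iota> a1 + \<iota> b1 * t + \<iota> c1 * (t * t)" "y = \<iota> a2 + \<iota> b2 * t + \<iota> c2 * (t * t)"
    by auto
  have "x - y = \<iota> (a1 - a2) + \<iota> (b1 - b2) * t + \<iota> (c1 - c2) * (t * t)"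
    unfolding xy by (simp add: hom algebra_simps)
  then show "x - y \<in> ?E" using E by simp
  \<comment> \<open>Omitting \<open>\<iota>\<close>, the terms with \<open>c1 * c2\<close> use
    \<open>t^4 = e * c + (c + e * d) * t + (d + e * e) * t^2\<close>.\<close>
  have "x * y = \<iota> (a1 * a2 + (b1 * c2 + c1 * b2) * c + c1 * c2 * e * c)
      + \<iota> (a1 * b2 + b1 * a2 + (b1 * c2 + c1 * b2) * d + c1 * c2 * (c + e * d)) * t
      + \<iota> (a1 * c2 + b1 * b2 + c1 * a2 + (b1 * c2 + c1 * b2) * e + c1 * c2 * (d + e * e)) * (t * t)"
    unfolding xy hom using t3 by algebra
  then show "x * y \<in> ?E" using E by simp
qed

text \<open>Scaling a plane to \<open>\<langle>1, t\<rangle>\<close>, the four elements \<open>1\<close>, \<open>1 / t\<close>, \<open>1 / (t + 1)\<close>, \<open>1 / (t + b)\<close> of the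
  scaled \<open>B\<close> are linearly dependent, so \<open>t\<close> has degree at most three. In degree two the plane is
  a multiple of the quadratic field; in degree three \<open>B\<close> is a multiple of the cubic field.\<close>

lemma inverse_plane_subset_cases:
  assumes A: "subspace A" "card A = CARD('f) ^ 3"
    and B: "subspace B" "card B = CARD('f) ^ 3"
    and q: "CARD('f) > 2"
    and xy: "x \<in> A" "y \<in> A" "indep2 x y"
    and plane: "\<And>a b. \<iota> a * x + \<iota> b * y \<noteq> 0 \<Longrightarrow> inverse (\<iota> a * x + \<iota> b * y) \<in> B"
  shows "(\<exists>S. one_dim_subspace_over_subfield_of_card (CARD('f) ^ 2) S \<and> S \<subseteq> (inverse_set A \<inter> B) \<union> {0})
    \<or> inverse_set A \<subseteq> B \<or> card {z\<in>A. z \<noteq> 0 \<and> inverse z \<in> B} < CARD('f) ^ 2"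
proof -
  have x0: "x \<noteq> 0" using indep2_nonzero xy(3) by blast
  define t where "t = y / x"
  have y: "y = t * x" using x0 by (simp add: t_def)
  have t: "t \<notin> range \<iota>"
  proof
    assume "t \<in> range \<iota>"
    then obtain a where "t = \<iota> a" by blast
    then have "\<iota> a * x + \<iota> (- 1) * y = 0" by (simp add: y hom)
    with xy(3) show False unfolding indep2_def by fastforce
  qed
  have tb: "t + \<iota> b \<noteq> 0" for b
    using t by (metis add_eq_0_iff2 rangeI uminus)
  show ?thesis
  proof (cases "indep3 1 t (t * t)")
    case False
    have "indep2 1 t" by (rule indep2I) (use t in auto)
    then obtain c d where t2: "t * t = \<iota> c + \<iota> d * t"
      using indep3_extend[OF _ False] by auto
    define E where "E = range (\<lambda>(a, b). \<iota> a + \<iota> b * t)"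
    have E: "is_subfield E" "card E = CARD('f) ^ 2"
      unfolding E_def using quadratic_ring_is_subfield[OF t t2] by blast+
    \<comment> \<open>As \<open>E\<close> is closed under inverses, \<open>S\<close> consists of 0
      and the inverses of the nonzero points of the plane.\<close>
    define S where "S = {c * inverse x |c. c \<in> E}"
    have "S \<subseteq> (inverse_set A \<inter> B) \<union> {0}"
    proof
      fix s assume "s \<in> S"
      then obtain e where e: "e \<in> E" "s = e * inverse x" unfolding S_def by blast
      have "inverse e \<in> E" using E(1) e(1) unfolding is_subfield_def by blast
      then obtain a b where ab: "inverse e = \<iota> a + \<iota> b * t" unfolding E_def by auto
      have inv: "s = inverse (\<iota> a * x + \<iota> b * y)"
      proof -
        have "s = inverse (inverse e * x)" using e(2) by simp
        then show ?thesis unfolding ab y by (simp add: algebra_simps)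
      qed
      show "s \<in> (inverse_set A \<inter> B) \<union> {0}"
      proof (cases "\<iota> a * x + \<iota> b * y = 0")
        case True
        then show ?thesis by (simp add: inv)
      next
        case False
        then show ?thesis
          using plane subspace_comb[OF A(1) xy(1,2)] unfolding inv inverse_set_def by blast
      qed
    qed
    moreover have "one_dim_subspace_over_subfield_of_card (CARD('f) ^ 2) S"
      unfolding one_dim_subspace_over_subfield_of_card_def S_def
      using E x0 by (intro exI[of _ E] exI[of _ "inverse x"]) simp
    ultimately show ?thesis by blast
  next
    case True
    then have indep: "a = 0 \<and> b = 0 \<and> c = 0"
      if "\<iota> a + \<iota> b * t + \<iota> c * (t * t) = 0" for a b c
      using that unfolding indep3_def by (metis mult.right_neutral)
    have t0: "t \<noteq> 0" "t + 1 \<noteq> 0" using tb[of 0] tb[of 1] by simp_all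
    \<comment> \<open>These are the inverses of the plane points
      \<open>\<iota> b * x + y\<close>.\<close>
    define w where "w b = inverse (x * (t + \<iota> b))" for b
    have B_mem: "inverse x \<in> B" "w b \<in> B" for b
    proof -
      show "inverse x \<in> B" using plane[of 1 0] x0 by simp
      have "x * (t + \<iota> b) = \<iota> b * x + \<iota> 1 * y" by (simp add: y algebra_simps)
      then show "w b \<in> B" unfolding w_def using plane[of b 1] tb[of b] x0 by (metis mult_eq_0_iff)
    qed
    have w_inverse: "x * (t + \<iota> b) * w b = 1" for b
      unfolding w_def by (rule right_inverse) (use x0 tb[of b] in simp)
    \<comment> \<open>Clearing denominators turns a linear relation between
      \<open>inverse x\<close>, \<open>w 0\<close> and \<open>w 1\<close> into one between 1,
      \<open>t\<close> and \<open>t * t\<close>.\<close>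
    have clear: "x * t * (t + 1) * (\<iota> a * inverse x + \<iota> b * w 0 + \<iota> c * w 1)
        = \<iota> b + (\<iota> a + \<iota> b + \<iota> c) * t + \<iota> a * (t * t)" for a b c
    proof -
      have "x * inverse x = 1" "x * t * w 0 = 1" "x * (t + 1) * w 1 = 1"
        using x0 w_inverse[of 0] w_inverse[of 1] by simp_all
      then show ?thesis by algebra
    qed
    have "indep3 (inverse x) (w 0) (w 1)"
      unfolding indep3_def
    proof (intro allI impI)
      fix a b c assume "\<iota> a * inverse x + \<iota> b * w 0 + \<iota> c * w 1 = 0"
      then have "\<iota> b + \<iota> (a + b + c) * t + \<iota> a * (t * t) = 0" using clear[of a b c] by (simp add: hom)
      from indep[OF this] show "a = 0 \<and> b = 0 \<and> c = 0" by auto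
    qed
    from indep3_spans[OF B this B_mem(1) B_mem(2) B_mem(2)]
    have B_span: "\<exists>a b c. v = \<iota> a * inverse x + \<iota> b * w 0 + \<iota> c * w 1" if "v \<in> B" for v
      using that by auto
    \<comment> \<open>A third scalar exists since \<open>q > 2\<close>; expanding \<open>w r\<close>
      in the basis of \<open>B\<close> just found yields a cubic equation for
      \<open>t\<close>.\<close>
    obtain r :: 'f where r: "r \<noteq> 0" "r \<noteq> 1"
    proof -
      have "\<exists>r. r \<notin> {0, 1 :: 'f}"
      proof (rule ccontr)
        assume "\<not> ?thesis"
        then have "UNIV = {0, 1 :: 'f}" by auto
        then have "CARD('f) = card {0, 1 :: 'f}" by simp
        then show False using q by simp
      qed
      then show ?thesis using that by auto
    qed
    obtain a b c where abc: "w r = \<iota> a * inverse x + \<iota> b * w 0 + \<iota> c * w 1"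
      using B_span[OF B_mem(2)] by blast
    have rel: "t * (t + 1) = (\<iota> b + (\<iota> a + \<iota> b + \<iota> c) * t + \<iota> a * (t * t)) * (t + \<iota> r)"
      using clear[of a b c] abc w_inverse[of r] by algebra
    \<comment> \<open>This is the leading coefficient of the cubic equation. If it were zero,
      comparing coefficients would give \<open>b = 0\<close>, \<open>c = 1\<close> and then
      \<open>r = 1\<close>.\<close>
    have a: "a \<noteq> 0"
    proof
      assume "a = 0"
      with rel have "t * (t + 1) = (\<iota> b + (\<iota> b + \<iota> c) * t) * (t + \<iota> r)" by simp
      then have "\<iota> (b * r) + \<iota> (b + (b + c) * r - 1) * t + \<iota> (b + c - 1) * (t * t) = 0"
        unfolding hom one by algebra
      from indep[OF this] show False using r by auto
    qed
    have "t * t * t = \<iota> (- b * r / a) + \<iota> ((1 - b - (a + b + c) * r) / a) * t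
        + \<iota> ((1 - (a + b + c) - a * r) / a) * (t * t)"
    proof -
      have "\<iota> a * (t * t * t) = \<iota> (- b * r) + \<iota> (1 - b - (a + b + c) * r) * t
          + \<iota> (1 - (a + b + c) - a * r) * (t * t)"
        unfolding hom one using rel by algebra
      moreover have "u = \<iota> (c0 / a) + \<iota> (c1 / a) * t + \<iota> (c2 / a) * (t * t)"
        if "\<iota> a * u = \<iota> c0 + \<iota> c1 * t + \<iota> c2 * (t * t)" for u c0 c1 c2
        using that a by (simp add: divide field_simps)
      ultimately show ?thesis by blast
    qed
    note field = cubic_ring_is_subfield[OF this]
    define E where "E = range (\<lambda>(a, b, c). \<iota> a * 1 + \<iota> b * t + \<iota> c * (t * t))"
    have E: "\<And>u v. u \<in> E \<Longrightarrow> v \<in> E \<Longrightarrow> u * v \<in> E" "\<And>u. u \<in> E \<Longrightarrow> inverse u \<in> E"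
        "\<And>u v. u \<in> E \<Longrightarrow> v \<in> E \<Longrightarrow> u - v \<in> E"
      using field unfolding is_subfield_def E_def by blast+
    have poly_E: "\<iota> a + \<iota> b * t + \<iota> c * (t * t) \<in> E" for a b c
      unfolding E_def by (rule image_eqI[of _ _ "(a, b, c)"]) simp_all
    have E_eq: "card E = CARD('f) ^ 3"
      unfolding E_def by (subst card_image[OF indep3_inj[OF True]]) (simp add: power3_eq_cube)
    \<comment> \<open>By \<open>clear\<close>, each element of \<open>B\<close> is a quotient of
      elements of \<open>E\<close> divided by \<open>x\<close>; equality follows because both sets
      have \<open>q^3\<close> elements.\<close>
    have B_eq: "B = (\<lambda>e. e * inverse x) ` E"
    proof (rule card_subset_eq)
      show "finite ((\<lambda>e. e * inverse x) ` E)" by (simp add: E_def)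
      show "card B = card ((\<lambda>e. e * inverse x) ` E)"
        using x0 by (subst card_image) (simp_all add: inj_on_def B(2) E_eq)
      show "B \<subseteq> (\<lambda>e. e * inverse x) ` E"
      proof
        fix v assume "v \<in> B"
        then obtain a b c where v: "v = \<iota> a * inverse x + \<iota> b * w 0 + \<iota> c * w 1" using B_span by blast
        let ?n = "\<iota> b + \<iota> (a + b + c) * t + \<iota> a * (t * t)" and ?d = "\<iota> 0 + \<iota> 1 * t + \<iota> 1 * (t * t)"
        have "x * (?d * v) = ?n" using clear[of a b c] unfolding v hom by (simp add: algebra_simps)
        moreover have d0: "?d \<noteq> 0" using t0
        proof -
          have "?d = t * (t + 1)" by (simp add: algebra_simps)
          then show ?thesis using t0 by simp
        qed
        moreover have "v = n * inverse d * inverse x" if "x * (d * v) = n" "d \<noteq> 0" for n d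
          using that x0 by (auto simp: field_simps)
        ultimately have "v = ?n * inverse ?d * inverse x" by blast
        then show "v \<in> (\<lambda>e. e * inverse x) ` E" using E poly_E by blast
      qed
    qed
    have B_iff: "inverse z \<in> B \<longleftrightarrow> z * inverse x \<in> E" if "z \<noteq> 0" for z
    proof -
      have "inverse z = e * inverse x \<longleftrightarrow> e = x * inverse z" for e
        using x0 that by (auto simp: field_simps)
      then have "inverse z \<in> (\<lambda>e. e * inverse x) ` E \<longleftrightarrow> x * inverse z \<in> E"
        by (simp add: image_iff)
      also have "\<dots> \<longleftrightarrow> z * inverse x \<in> E"
        using E(2)[of "x * inverse z"] E(2)[of "z * inverse x"] by (auto simp: mult.commute)
      finally show ?thesis using B_eq by simp
    qed
    \<comment> \<open>By \<open>B_iff\<close>, the vectors of \<open>A\<close> with inverse in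
      \<open>B\<close> form, together with 0, a subspace containing the plane. It is either all of
      \<open>A\<close> or the plane itself.\<close>
    show ?thesis
    proof (cases "\<exists>z\<in>A. z \<noteq> 0 \<and> inverse z \<in> B \<and> indep3 x y z")
      case True
      then obtain z where z: "z \<in> A" "z \<noteq> 0" "inverse z \<in> B" "indep3 x y z" by blast
      have "inverse u \<in> B" if u: "u \<in> A" "u \<noteq> 0" for u
      proof -
        have "u \<in> range (\<lambda>(a, b, c). \<iota> a * x + \<iota> b * y + \<iota> c * z)"
          using u(1) indep3_spans[OF A z(4) xy(1,2) z(1)] by blast
        then obtain a b c where "u = \<iota> a * x + \<iota> b * y + \<iota> c * z" by auto
        then have eq: "u * inverse x = (\<iota> a + \<iota> b * t + \<iota> 0 * (t * t))
            - (\<iota> (- c) + \<iota> 0 * t + \<iota> 0 * (t * t)) * (z * inverse x)"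
          using x0 by (simp add: y uminus field_simps)
        have zx: "z * inverse x \<in> E" using z B_iff by blast
        have "u * inverse x \<in> E" unfolding eq by (intro E(3) E(1) poly_E zx)
        then show ?thesis using B_iff u by blast
      qed
      then show ?thesis unfolding inverse_set_def by blast
    next
      case False
      let ?S = "{z\<in>A. z \<noteq> 0 \<and> inverse z \<in> B}" and ?U = "{\<iota> a * x + \<iota> b * y |a b. True}"
      have "?U = (\<lambda>(a, b). \<iota> a * x + \<iota> b * y) ` UNIV" by auto
      then have fin: "finite ?U" by simp
      have "?S \<subset> ?U"
      proof
        show "?S \<subseteq> ?U" using indep3_extend[OF xy(3)] False by blast
        \<comment> \<open>The element 0 is in the plane but not in \<open>?S\<close>, which makes
          the bound strict.\<close>
        have "0 \<in> ?U" by (auto intro: exI[of _ 0])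
        then show "?S \<noteq> ?U" by blast
      qed
      then have "card ?S < card ?U" by (rule psubset_card_mono[OF fin])
      then show ?thesis using card_plane[of x y] by linarith
    qed
  qed
qed

end

section \<open>Cubics without lines and with more than \<open>2q + 1\<close> projective
  zeros\<close>

locale cubic_arc = finite_scalars \<iota> for \<iota> :: "'f::{field,finite} \<Rightarrow> 'c::field" +
  fixes F :: "'c \<Rightarrow> 'c" and D :: "'c \<Rightarrow> 'c \<Rightarrow> 'c" and V :: "'c set"
  assumes cubic: "cubic F D"
    and V: "subspace V" "card V = CARD('f) ^ 3"
    and no_line: "\<And>x y. x \<in> V \<Longrightarrow> y \<in> V \<Longrightarrow> indep2 x y \<Longrightarrow> \<exists>a b. F (\<iota> a * x + \<iota> b * y) \<noteq> 0"
    and q_gt_3: "CARD('f) > 3"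
    and many: "card {x\<in>V. x \<noteq> 0 \<and> F x = 0} > (CARD('f) - 1) * (2 * CARD('f) + 1)"
begin

lemma F_comb: "F (\<iota> s * x + \<iota> t * y) =
    \<iota> s ^ 3 * F x + \<iota> s ^ 2 * \<iota> t * D x y + \<iota> s * \<iota> t ^ 2 * D y x + \<iota> t ^ 3 * F y"
  using cubic unfolding cubic_def by blast

lemma D_comb: "D x (\<iota> s * y + \<iota> t * z) = \<iota> s * D x y + \<iota> t * D x z"
  using cubic unfolding cubic_def by blast

lemma D_self: "D x x = 3 * F x"
  using cubic unfolding cubic_def by blast

lemma F_shift: "F x = 0 \<Longrightarrow> F (y + \<iota> s * x) = \<iota> s ^ 2 * D x y + \<iota> s * D y x + F y"
  using F_comb[of s x 1 y] by (simp add: add.commute)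

lemma F_scale: "F (\<iota> s * x) = \<iota> s ^ 3 * F x"
  using F_comb[of s x 0 x] by simp

lemma V_closed:
  "x \<in> V \<Longrightarrow> y \<in> V \<Longrightarrow> x + y \<in> V" "x \<in> V \<Longrightarrow> \<iota> s * x \<in> V"
  using V(1) by (auto intro: subspace_add subspace_scale)

lemma not_all_0:
  assumes "x \<in> V" "y \<in> V" "indep2 x y" "F x = 0" "D x y = 0" "D y x = 0" "F y = 0"
  shows False
  using no_line[OF assms(1-3)] assms(4-) by (simp add: F_comb)

text \<open>The points other than \<open>x\<close> on the line through \<open>x\<close> and
  \<open>y\<close> are the \<open>y + \<iota> s * x\<close>, so this parametrizes the zeros on the
  line apart from \<open>x\<close>.\<close>

definition meets :: "'c \<Rightarrow> 'c \<Rightarrow> 'f set" where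
  "meets x y = {s. F (y + \<iota> s * x) = 0}"

text \<open>As \<open>F x = 0\<close>, the cubic term in \<open>s\<close> drops out. The remaining
  quadratic is not the zero polynomial because the cubic contains no line.\<close>

lemma card_meets_le_degree:
  assumes "x \<in> V" "y \<in> V" "indep2 x y" "F x = 0"
  shows "card (meets x y) \<le> degree [:F y, D y x, D x y:]"
proof -
  let ?p = "[:F y, D y x, D x y:]"
  have p0: "?p \<noteq> 0" using not_all_0[OF assms] by auto
  have "poly ?p (\<iota> s) = F (y + \<iota> s * x)" for s
    unfolding F_shift[OF assms(4)] by (simp add: power2_eq_square distrib_left ac_simps)
  then have "\<iota> ` meets x y \<subseteq> {z. poly ?p z = 0}" by (auto simp: meets_def)
  then have "card (\<iota> ` meets x y) \<le> card {z. poly ?p z = 0}"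
    using p0 by (intro card_mono poly_roots_finite)
  also have "\<dots> \<le> degree ?p" by (rule card_poly_roots_bound[OF p0])
  finally show ?thesis by (simp add: card_image inj_on_def)
qed

lemma card_meets_le_2:
  assumes "x \<in> V" "y \<in> V" "indep2 x y" "F x = 0"
  shows "card (meets x y) \<le> 2"
  using card_meets_le_degree[OF assms] by (simp split: if_splits)

text \<open>The line is tangent at \<open>x\<close>, so the leading coefficient of the quadratic
  vanishes.\<close>

lemma card_meets_le_1:
  assumes "x \<in> V" "y \<in> V" "indep2 x y" "F x = 0" "D x y = 0"
  shows "card (meets x y) \<le> 1"
  using card_meets_le_degree[OF assms(1-4)] assms(5) by (simp split: if_splits)

text \<open>Two scalar roots \<open>a\<close> and \<open>b\<close> factor the quadratic as
  \<open>(s - a) * (s - b)\<close> times its leading coefficient \<open>D x y\<close>.\<close>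

lemma F_shift_two_roots:
  assumes "F x = 0" "card (meets x y) = 2"
  shows "\<exists>r. F (y + \<iota> s * x) = \<iota> r * D x y"
proof -
  obtain a b where "meets x y = {a, b}" "a \<noteq> b" using assms(2) by (meson card_2_iff)
  then have a: "\<iota> a ^ 2 * D x y + \<iota> a * D y x + F y = 0"
    and b: "\<iota> b ^ 2 * D x y + \<iota> b * D y x + F y = 0"
    using F_shift[OF assms(1), of y] unfolding meets_def by force+
  have "(\<iota> a - \<iota> b) * ((\<iota> a + \<iota> b) * D x y + D y x) = 0"
    using a b by algebra
  then have "(\<iota> a + \<iota> b) * D x y + D y x = 0" using \<open>a \<noteq> b\<close> by simp
  with a have "\<iota> s ^ 2 * D x y + \<iota> s * D y x + F y = (\<iota> s - \<iota> a) * (\<iota> s - \<iota> b) * D x y"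
    by algebra
  then have "F (y + \<iota> s * x) = \<iota> ((s - a) * (s - b)) * D x y"
    by (simp add: F_shift[OF assms(1)] hom)
  then show ?thesis by blast
qed

lemma card_meets_scale_le:
  assumes "b \<noteq> 0"
  shows "card (meets x (\<iota> b * y)) \<le> card (meets x y)"
proof (rule card_inj_on_le[where f="\<lambda>s. s / b"])
  show "inj_on (\<lambda>s. s / b) (meets x (\<iota> b * y))" using assms by (simp add: inj_on_def)
  show "(\<lambda>s. s / b) ` meets x (\<iota> b * y) \<subseteq> meets x y"
  proof (clarsimp simp: meets_def)
    fix s assume "F (\<iota> b * y + \<iota> s * x) = 0"
    moreover have "\<iota> b * y + \<iota> s * x = \<iota> b * (y + \<iota> (s / b) * x)"
      using assms by (simp add: hom field_simps)
    ultimately show "F (y + \<iota> (s / b) * x) = 0" using assms by (simp add: F_scale)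
  qed
qed simp

text \<open>Projectively: every line through the zero \<open>x\<close> contains at most two further zeros, so two
  lines containing together at most two further zeros would leave at most \<open>2q + 1\<close> zeros.\<close>

lemma card_meets_add:
  assumes x: "x \<in> V" "F x = 0" and yz: "y \<in> V" "z \<in> V" and i: "indep3 x y z"
  shows "card (meets x y) + card (meets x z) \<ge> 3"
proof -
  \<comment> \<open>A projective point has \<open>n\<close> nonzero representatives, so each count
    of vectors below is \<open>n\<close> times a count of points.\<close>
  define n where "n = CARD('f) - 1"
  let ?N = "UNIV - {0 :: 'f}"
  have n: "card ?N = n" by (simp add: n_def)
  have le2: "card (meets x (\<iota> b * y + \<iota> c * z)) \<le> 2" if "b \<noteq> 0" for b c
  proof (rule card_meets_le_2)
    show "indep2 x (\<iota> b * y + \<iota> c * z)"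
      unfolding indep2_def
    proof (intro allI impI)
      fix s t assume "\<iota> s * x + \<iota> t * (\<iota> b * y + \<iota> c * z) = 0"
      then have "\<iota> s * x + \<iota> (t * b) * y + \<iota> (t * c) * z = 0" by (simp add: hom algebra_simps)
      with i have "s = 0 \<and> t * b = 0" unfolding indep3_def by blast
      then show "s = 0 \<and> t = 0" using that by simp
    qed
  qed (use x yz V_closed in auto)
  let ?S = "{u\<in>V. u \<noteq> 0 \<and> F u = 0}"
  let ?P = "\<lambda>w. (\<lambda>s. w + \<iota> s * x) ` meets x w"
  have cP: "card (?P w) \<le> card (meets x w)" for w by (rule card_image_le) simp
  have cU: "card (\<Union>b\<in>?N. ?P (\<iota> b * w)) \<le> n * card (meets x w)" for w
  proof -
    have "card (\<Union>b\<in>?N. ?P (\<iota> b * w)) \<le> (\<Sum>b\<in>?N. card (?P (\<iota> b * w)))" by (rule card_UN_le) simp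
    also have "\<dots> \<le> (\<Sum>b\<in>?N. card (meets x w))"
      by (intro sum_mono order_trans[OF cP] card_meets_scale_le) simp
    finally show ?thesis by (simp add: n)
  qed
  have "card (\<Union>(b, c)\<in>?N \<times> ?N. ?P (\<iota> b * y + \<iota> c * z))
      \<le> (\<Sum>(b, c)\<in>?N \<times> ?N. card (?P (\<iota> b * y + \<iota> c * z)))"
    using card_UN_le[of "?N \<times> ?N" "\<lambda>(b, c). ?P (\<iota> b * y + \<iota> c * z)"]
    by (simp add: case_prod_unfold)
  also have "\<dots> \<le> (\<Sum>(b, c)\<in>?N \<times> ?N. 2)"
    by (intro sum_mono) (auto intro!: order_trans[OF cP] le2)
  finally have cUU: "card (\<Union>(b, c)\<in>?N \<times> ?N. ?P (\<iota> b * y + \<iota> c * z)) \<le> n * (2 * n)"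
    by (simp add: n card_cartesian_product)
  let ?X = "(\<lambda>a. \<iota> a * x) ` ?N"
  let ?Y = "\<Union>b\<in>?N. ?P (\<iota> b * y)"
  let ?Z = "\<Union>b\<in>?N. ?P (\<iota> b * z)"
  let ?YZ = "\<Union>(b, c)\<in>?N \<times> ?N. ?P (\<iota> b * y + \<iota> c * z)"
  \<comment> \<open>Zeros are sorted by which of their coordinates along \<open>y\<close> and
    \<open>z\<close> vanish.\<close>
  have "?S \<subseteq> ?X \<union> ?Y \<union> ?Z \<union> ?YZ"
  proof
    fix u assume u: "u \<in> ?S"
    then have "u \<in> range (\<lambda>(a, b, c). \<iota> a * x + \<iota> b * y + \<iota> c * z)"
      using indep3_spans[OF V i x(1) yz] by blast
    then obtain a b c where abc: "u = \<iota> a * x + \<iota> b * y + \<iota> c * z" by auto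
    have in_P: "u \<in> ?P (\<iota> b * y + \<iota> c * z)"
      using u by (intro image_eqI[of _ _ a]) (auto simp: abc meets_def algebra_simps)
    consider "b = 0" "c = 0" | "b \<noteq> 0" "c = 0" | "b = 0" "c \<noteq> 0" | "b \<noteq> 0" "c \<noteq> 0" by blast
    then show "u \<in> ?X \<union> ?Y \<union> ?Z \<union> ?YZ"
    proof cases
      case 1
      then have "a \<noteq> 0" using u abc by auto
      then have "u \<in> ?X" using abc 1 by (intro image_eqI[of _ _ a]) simp_all
      then show ?thesis by blast
    next
      case 2
      then have "u \<in> ?P (\<iota> b * y)" using in_P by simp
      then show ?thesis using 2 by blast
    next
      case 3
      then have "u \<in> ?P (\<iota> c * z)" using in_P by simp
      then show ?thesis using 3 by blast
    next
      case 4
      then have "u \<in> ?YZ" using in_P by blast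
      then show ?thesis by blast
    qed
  qed
  then have "card ?S \<le> card (?X \<union> ?Y \<union> ?Z \<union> ?YZ)" by (intro card_mono) auto
  also have "\<dots> \<le> card ?X + card ?Y + card ?Z + card ?YZ"
    by (meson add_le_mono card_Un_le le_refl order_trans)
  also have "\<dots> \<le> n + n * card (meets x y) + n * card (meets x z) + n * (2 * n)"
    using card_image_le[of ?N "\<lambda>a. \<iota> a * x"] cU[of y] cU[of z] cUU n by (intro add_mono) auto
  also have "\<dots> = n * (1 + card (meets x y) + card (meets x z) + 2 * n)"
    by (simp add: algebra_simps)
  finally have "n * (2 * CARD('f) + 1) < n * (1 + card (meets x y) + card (meets x z) + 2 * n)"
    using many by (simp add: n_def)
  then have "2 * CARD('f) + 1 < 1 + card (meets x y) + card (meets x z) + 2 * n" by simp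
  \<comment> \<open>Inserting \<open>n = q - 1\<close> leaves that the sum exceeds 2.\<close>
  then show ?thesis using q_gt_3 by (simp add: n_def)
qed

lemma third_vector:
  assumes "x \<in> V" "y \<in> V" "indep2 x y"
  obtains z where "z \<in> V" "indep3 x y z"
  using indep3_exists[OF V(2) assms(3)] by blast

text \<open>The derivative \<open>D x\<close> takes values in \<open>'c\<close>, so its kernel on \<open>V\<close> could be just the multiples of \<open>x\<close>.
  But on a line with three zeros, \<open>F\<close> at any point is a scalar multiple of \<open>D x\<close> at that point, for
  each zero \<open>x\<close> on the line. Comparing through a second zero \<open>p\<close> two points \<open>X\<close>, \<open>Y\<close> of a line that
  avoids \<open>x\<close> shows that \<open>D x X\<close> and \<open>D x Y\<close> have ratio in the scalar field.\<close>

lemma tangent_exists: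
  assumes x: "x \<in> V" "x \<noteq> 0" "F x = 0"
  shows "\<exists>w\<in>V. indep2 x w \<and> D x w = 0"
proof -
  \<comment> \<open>This takes the exceptional line through \<open>x\<close> if there is
    one.\<close>
  obtain y0 where y0: "y0 \<in> V" "indep2 x y0"
      and y0': "card (meets x y0) \<noteq> 2 \<or> (\<forall>y\<in>V. indep2 x y \<longrightarrow> card (meets x y) = 2)"
    using indep2_exists[OF V(2) x(2)] by blast
  obtain z0 where "z0 \<in> V" "indep3 x y0 z0" using third_vector[OF x(1) y0] .
  then have "card (meets x y0) + card (meets x z0) \<ge> 3" "card (meets x z0) \<le> 2"
    using card_meets_add card_meets_le_2 indep3_indep2 x y0 by blast+
  then have "card (meets x y0) > 0" by linarith
  then obtain s where s: "s \<in> meets x y0" by (metis card_gt_0_iff ex_in_conv)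
  \<comment> \<open>A second zero on the line of \<open>y0\<close>; every line through
    \<open>x\<close> that misses \<open>p\<close> then has two further zeros.\<close>
  define p where "p = y0 + \<iota> s * x"
  have p: "p \<in> V" "F p = 0" "indep2 x p"
    using s y0 x V_closed indep2_shift by (auto simp: p_def meets_def)
  have full: "card (meets x y) = 2" if y: "y \<in> V" "indep3 x p y" for y
  proof -
    have i: "indep3 x y0 y" using indep3_shift y(2) unfolding p_def .
    have "card (meets x y0) + card (meets x y) \<ge> 3"
      using card_meets_add[OF x(1,3) y0(1) y(1) i] .
    moreover have "card (meets x y) \<le> 2" "card (meets x y0) \<le> 2"
      using card_meets_le_2 x y0 y indep3_indep2[OF i] by blast+
    moreover have "card (meets x y) = 2 \<or> card (meets x y0) \<noteq> 2"
      using y0' y(1) indep3_indep2(2)[OF i] by blast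
    ultimately show ?thesis by linarith
  qed
  \<comment> \<open>The lines from \<open>p\<close> to \<open>z0\<close> and to
    \<open>z0 + x\<close> both avoid \<open>x\<close>, and at least one of them has two further
    zeros.\<close>
  obtain z where z: "z \<in> V" "indep3 x p z" "card (meets p z) = 2"
  proof -
    obtain z0 where z0: "z0 \<in> V" "indep3 x p z0" using third_vector[OF x(1) p(1,3)] .
    have i: "indep3 x p (z0 + x)" "indep3 p z0 (z0 + x)"
    proof -
      have "a = 0 \<and> b = 0 \<and> c = 0" if "\<iota> a * x + \<iota> b * p + \<iota> c * (z0 + x) = 0" for a b c
      proof -
        have "\<iota> (a + c) * x + \<iota> b * p + \<iota> c * z0 = 0" using that by (simp add: hom algebra_simps)
        with z0(2) have "a + c = 0" "b = 0" "c = 0" unfolding indep3_def by blast+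
        then show ?thesis by simp
      qed
      then show "indep3 x p (z0 + x)" unfolding indep3_def by blast
      have "a = 0 \<and> b = 0 \<and> c = 0" if "\<iota> a * p + \<iota> b * z0 + \<iota> c * (z0 + x) = 0" for a b c
      proof -
        have "\<iota> c * x + \<iota> a * p + \<iota> (b + c) * z0 = 0" using that by (simp add: hom algebra_simps)
        with z0(2) have "b + c = 0" "a = 0" "c = 0" unfolding indep3_def by blast+
        then show ?thesis by simp
      qed
      then show "indep3 p z0 (z0 + x)" unfolding indep3_def by blast
    qed
    have zx: "z0 + x \<in> V" using z0 x V_closed by blast
    have "card (meets p z0) + card (meets p (z0 + x)) \<ge> 3"
      using card_meets_add[OF p(1,2) z0(1) zx i(2)] .
    moreover have "card (meets p z0) \<le> 2" "card (meets p (z0 + x)) \<le> 2"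
      using card_meets_le_2 p z0 zx indep3_indep2[OF i(2)] by blast+
    ultimately have "card (meets p z0) = 2 \<or> card (meets p (z0 + x)) = 2" by linarith
    then show ?thesis using that z0 zx i(1) by blast
  qed
  \<comment> \<open>Here \<open>q > 3\<close> leaves two parameters at which \<open>F\<close> does
    not vanish.\<close>
  have "card (UNIV - meets p z) \<ge> 2" using q_gt_3 z(3) by (simp add: card_Diff_subset)
  then obtain s t where st: "s \<noteq> t" "s \<notin> meets p z" "t \<notin> meets p z"
    by (metis (no_types, lifting) DiffD2 card_le_Suc0_iff_eq finite not_less_eq_eq numeral_2_eq_2)
  define X where "X = z + \<iota> s * p"
  define Y where "Y = z + \<iota> t * p"
  have XY: "X \<in> V" "Y \<in> V" "F X \<noteq> 0" "F Y \<noteq> 0"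
    using st z p V_closed by (auto simp: X_def Y_def meets_def)
  have indep_shift: "indep3 x p (z + \<iota> r * p)" for r
    unfolding indep3_def
  proof (intro allI impI)
    fix a b c assume "\<iota> a * x + \<iota> b * p + \<iota> c * (z + \<iota> r * p) = 0"
    then have "\<iota> a * x + \<iota> (b + c * r) * p + \<iota> c * z = 0" by (simp add: hom algebra_simps)
    with z(2) have "a = 0" "b + c * r = 0" "c = 0" unfolding indep3_def by blast+
    then show "a = 0 \<and> b = 0 \<and> c = 0" by simp
  qed
  have two: "card (meets x X) = 2" "card (meets x Y) = 2"
    using full XY indep_shift by (auto simp: X_def Y_def)
  obtain r1 r2 where r12: "F X = \<iota> r1 * D x X" "F Y = \<iota> r2 * D x Y"
    using F_shift_two_roots[OF x(3) two(1), of 0] F_shift_two_roots[OF x(3) two(2), of 0] by auto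
  obtain r3 r4 where r34: "F X = \<iota> r3 * D p z" "F Y = \<iota> r4 * D p z"
    using F_shift_two_roots[OF p(2) z(3)] unfolding X_def Y_def by blast
  have nz: "r1 \<noteq> 0" "r2 \<noteq> 0" "r3 \<noteq> 0" "r4 \<noteq> 0" using XY r12 r34 by auto
  \<comment> \<open>Both \<open>\<iota> (r1 * r4) * D x X\<close> and
    \<open>\<iota> (r2 * r3) * D x Y\<close> equal \<open>\<iota> (r3 * r4) * D p z\<close>, so
    \<open>D x\<close> kills this combination.\<close>
  define w where "w = \<iota> (r1 * r4) * X + \<iota> (- (r2 * r3)) * Y"
  have "w \<in> V" unfolding w_def using XY V_closed by blast
  moreover have "D x w = 0"
  proof -
    have "\<iota> r1 * \<iota> r4 * D x X = \<iota> r2 * \<iota> r3 * D x Y"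
      using r12 r34 by algebra
    then show ?thesis unfolding w_def D_comb by (simp add: hom)
  qed
  moreover have "indep2 x w"
    unfolding indep2_def
  proof (intro allI impI)
    fix a b assume "\<iota> a * x + \<iota> b * w = 0"
    then have "\<iota> a * x + \<iota> (b * (r1 * r4 * s - r2 * r3 * t)) * p + \<iota> (b * (r1 * r4 - r2 * r3)) * z = 0"
      by (simp add: w_def X_def Y_def hom algebra_simps)
    with z(2) have "a = 0" "b * (r1 * r4 * s - r2 * r3 * t) = 0" "b * (r1 * r4 - r2 * r3) = 0"
      unfolding indep3_def by blast+
    moreover have "b = 0"
    proof (rule ccontr)
      assume "b \<noteq> 0"
      with calculation have "r1 * r4 * s = r2 * r3 * t" "r1 * r4 = r2 * r3" by auto
      then show False using nz st(1) by auto
    qed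
    ultimately show "a = 0 \<and> b = 0" by simp
  qed
  ultimately show ?thesis by blast
qed

text \<open>The tangent at a zero \<open>x\<close> contains exactly one further zero \<open>p\<close> and is the only line through
  \<open>p\<close> with fewer than three zeros. So it is also the tangent at \<open>p\<close>, which forces \<open>F\<close> to vanish on it.\<close>

lemma contradiction: False
proof -
  obtain x where x: "x \<in> V" "x \<noteq> 0" "F x = 0"
  proof -
    have "card {x\<in>V. x \<noteq> 0 \<and> F x = 0} > 0" using many by linarith
    then show ?thesis using that by (auto simp: card_gt_0_iff)
  qed
  obtain w where w: "w \<in> V" "indep2 x w" "D x w = 0" using tangent_exists[OF x] by blast
  obtain u where u: "u \<in> V" "indep3 x w u" using third_vector[OF x(1) w(1,2)] .
  have "card (meets x w) + card (meets x u) \<ge> 3" "card (meets x u) \<le> 2"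
    using card_meets_add card_meets_le_2 indep3_indep2 x w u by blast+
  then have "card (meets x w) > 0" by linarith
  then obtain s where s: "s \<in> meets x w" by (metis card_gt_0_iff ex_in_conv)
  define p where "p = w + \<iota> s * x"
  have p: "p \<in> V" "F p = 0" "indep2 x p"
    using s w x V_closed indep2_shift by (auto simp: p_def meets_def)
  have Dxp: "D x p = 0"
    using D_comb[of x 1 w s x] w(3) x(3) by (simp add: p_def D_self)
  have p0: "p \<noteq> 0" using indep2_nonzero[OF indep2_sym[OF p(3)]] .
  obtain v where v: "v \<in> V" "indep2 p v" "D p v = 0" using tangent_exists[OF p(1) p0 p(2)] by blast
  have Dpx: "D p x \<noteq> 0" using not_all_0[OF x(1) p(1,3)] x(3) p(2) Dxp by blast
  \<comment> \<open>On this line \<open>F (x + \<iota> s * p)\<close> is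
    \<open>\<iota> s ^ 2 * D p x\<close>, which vanishes only at \<open>s = 0\<close>.\<close>
  have "meets p x \<subseteq> {0}"
    using Dpx by (auto simp: meets_def F_shift[OF p(2)] Dxp x(3))
  then have "card (meets p x) \<le> 1" using card_mono[of "{0::'f}" "meets p x"] by simp
  moreover have "card (meets p v) \<le> 1" using card_meets_le_1 p v by blast
  \<comment> \<open>Two distinct lines through \<open>p\<close> cannot both have at most one further
    zero, so the tangent at \<open>p\<close> is the line through \<open>x\<close>.\<close>
  ultimately have "\<not> indep3 p x v" using card_meets_add[OF p(1,2) x(1) v(1)] by fastforce
  then obtain a b where ab: "v = \<iota> a * p + \<iota> b * x"
    using indep3_extend[OF indep2_sym[OF p(3)]] by blast
  then have "\<iota> b * D p x = 0" using v(3) p(2) by (simp add: D_comb D_self)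
  then have "b = 0" using Dpx by simp
  then have "\<iota> a * p + \<iota> (- 1) * v = 0" using ab by (simp add: hom)
  with v(2) show False unfolding indep2_def by fastforce
qed

end

theorem corollary4:
  fixes \<iota> :: "'f::{field,finite} \<Rightarrow> 'c::alg_closed_field"
    and A B :: "'c set"
    and q :: nat
  assumes "CARD('f) = q" and "q > 3"
    and "algebraic_closure_embedding \<iota>"
    and "module.subspace (\<lambda>c x. \<iota> c * x) A" and "card A = q ^ 3"
    and "module.subspace (\<lambda>c x. \<iota> c * x) B" and "card B = q ^ 3"
    and "\<not> inverse_set A \<subseteq> B"
    and "real (card (inverse_set A \<inter> B)) / (real q - 1) > 2 * real q + 1"
  shows "\<exists>S. one_dim_subspace_over_subfield_of_card (q ^ 2) S \<and> S \<subseteq> (inverse_set A \<inter> B) \<union> {0}"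
proof -
  have q: "q = CARD('f)" using assms(1) by simp
  interpret finite_scalars \<iota>
    using assms(3) unfolding algebraic_closure_embedding_def by unfold_locales auto
  have A: "subspace A" "card A = CARD('f) ^ 3" and B: "subspace B" "card B = CARD('f) ^ 3"
    using assms by auto
  obtain F D where F: "cubic F D" "\<And>x. F x = 0 \<longleftrightarrow> x = 0 \<or> inverse x \<in> B"
    using cubic_inverse_subspace[OF B] by blast
  let ?S = "{x\<in>A. x \<noteq> 0 \<and> inverse x \<in> B}"
  have "inverse_set A \<inter> B = inverse ` ?S" unfolding inverse_set_def by auto
  then have "card (inverse_set A \<inter> B) = card ?S" by (simp add: card_image inj_on_def)
  with assms(9) have "real (card ?S) > (2 * real q + 1) * (real q - 1)"
    using assms(2) by (simp add: field_simps)
  also have "(2 * real q + 1) * (real q - 1) = real ((q - 1) * (2 * q + 1))"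
    using assms(2) by (simp add: of_nat_diff distrib_left distrib_right ac_simps)
  finally have many: "card ?S > (q - 1) * (2 * q + 1)" by linarith
  show ?thesis
  proof (rule ccontr)
    assume no: "\<not> ?thesis"
    \<comment> \<open>The bound by \<open>q^2\<close> rules out the last alternative of
      \<open>inverse_plane_subset_cases\<close>; writing \<open>q = m + 1\<close> removes the
      natural subtraction.\<close>
    obtain m where "q = m + 1"
      using assms(2) that[of "q - 1"] by simp
    then have "(q - 1) * (2 * q + 1) \<ge> q ^ 2"
      using assms(2) by (simp add: power2_eq_square algebra_simps)
    then have large: "card ?S \<ge> q ^ 2" using many by linarith
    have "cubic_arc \<iota> F D A"
    proof
      fix x y assume xy: "x \<in> A" "y \<in> A" "indep2 x y"
      show "\<exists>a b. F (\<iota> a * x + \<iota> b * y) \<noteq> 0"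
      proof (rule ccontr)
        assume "\<nexists>a b. F (\<iota> a * x + \<iota> b * y) \<noteq> 0"
        then have "inverse (\<iota> a * x + \<iota> b * y) \<in> B" if "\<iota> a * x + \<iota> b * y \<noteq> 0" for a b
          using that F(2) by blast
        \<comment> \<open>The three alternatives contradict \<open>no\<close>, the hypothesis on
          \<open>inverse_set A\<close>, and \<open>large\<close>, in this order.\<close>
        from inverse_plane_subset_cases[OF A B _ xy this] show False
          using no large assms(2,8) unfolding q by force
      qed
    next
      have "{x\<in>A. x \<noteq> 0 \<and> F x = 0} = ?S" using F(2) by blast
      then show "card {x\<in>A. x \<noteq> 0 \<and> F x = 0} > (CARD('f) - 1) * (2 * CARD('f) + 1)"
        using many by (simp add: q)
    qed (use F A assms(2) q in auto)
    then show False by (rule cubic_arc.contradiction)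
  qed
qed

end
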